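(* If there is an extraspecial $p$-group of cardinality $\omega_2$ which lies in $\mathcal{Y}_{\omega_2}$ but not in $\mathcal{Z}_{\omega_2}$, then there is a weak Kurepa tree.
   Context: For a prime $p$, a $p$-group $E$ is extraspecial if $\Phi(E)=E'=Z(E)\cong\mathbb{Z}_p$ (Frattini subgroup, derived subgroup, centre). For an infinite cardinal $\kappa$, $\mathcal{Z}_\kappa$ is the class of groups $G$ with $[G:C_G(U)]<\kappa$ for every subgroup $U$ generated by fewer than $\kappa$ elements, and $\mathcal{Y}_\kappa$ is the class of groups $G$ with $[G:N_G(U)]<\kappa$ for every subgroup $U$ generated by fewer than $\kappa$ elements. A tree is a partial order in which the set of predecessors of each element is well-ordered; levels and height are defined via the order types of these sets, and a branch is a maximal chain. A weak Kurepa tree is a tree of height $\omega_1$ with at least $\omega_2$ uncountable branches in which every level has cardinality at most $\omega_1$. *)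

theory Defs
  imports "HOL-Algebra.Algebra"
begin

section \<open>Extraspecial groups\<close>

definition centralizer :: "('a, 'b) monoid_scheme \<Rightarrow> 'a set \<Rightarrow> 'a set" where
  "centralizer G U = {g \<in> carrier G. \<forall>u\<in>U. g \<otimes>\<^bsub>G\<^esub> u = u \<otimes>\<^bsub>G\<^esub> g}"

definition group_center :: "('a, 'b) monoid_scheme \<Rightarrow> 'a set" where
  "group_center G = centralizer G (carrier G)"

definition maximal_subgroup :: "'a set \<Rightarrow> ('a, 'b) monoid_scheme \<Rightarrow> bool" where
  "maximal_subgroup M G \<longleftrightarrow>
     subgroup M G \<and> M \<noteq> carrier G \<and>
     (\<forall>H. subgroup H G \<and> M \<subseteq> H \<longrightarrow> H = M \<or> H = carrier G)"

text \<open>Intersecting with the carrier gives the usual convention that the Frattini subgroup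
  is the whole group when there are no maximal subgroups.\<close>

definition frattini :: "('a, 'b) monoid_scheme \<Rightarrow> 'a set" where
  "frattini G = carrier G \<inter> \<Inter>{M. maximal_subgroup M G}"

text \<open>Groups need not be finite. Since \<^term>\<open>group.ord G x\<close> is \<open>0\<close> for elements of infinite
  order, the following forces every element to have finite order.\<close>

definition p_group :: "nat \<Rightarrow> ('a, 'b) monoid_scheme \<Rightarrow> bool" where
  "p_group p G \<longleftrightarrow> group G \<and> (\<forall>x\<in>carrier G. \<exists>n. group.ord G x = p ^ n)"

definition extraspecial :: "nat \<Rightarrow> ('a, 'b) monoid_scheme \<Rightarrow> bool" where
  "extraspecial p G \<longleftrightarrow>
     Factorial_Ring.prime p \<and> p_group p G \<and>
     frattini G = derived G (carrier G) \<and>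
     derived G (carrier G) = group_center G \<and>
     G\<lparr>carrier := group_center G\<rparr> \<cong> integer_mod_group p"

section \<open>Cardinals and the classes \<open>Z\<close> and \<open>Y\<close>\<close>

text \<open>Ordinals are well-orders compared by \<open><o\<close>, \<open>\<le>o\<close>, \<open>=o\<close>, and cardinals are initial
  ordinals; \<open>\<omega>\<^sub>1\<close> is used below both as a cardinal and as an ordinal.\<close>

definition omega1 :: "nat set rel" (\<open>\<omega>\<^sub>1\<close>) where
  "\<omega>\<^sub>1 = cardSuc natLeq"

definition omega2 :: "nat set set rel" (\<open>\<omega>\<^sub>2\<close>) where
  "\<omega>\<^sub>2 = cardSuc \<omega>\<^sub>1"

definition generated_by_fewer ::
    "('a, 'b) monoid_scheme \<Rightarrow> 'k rel \<Rightarrow> 'a set \<Rightarrow> bool" where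
  "generated_by_fewer G \<kappa> U \<longleftrightarrow> (\<exists>S. S \<subseteq> carrier G \<and> |S| <o \<kappa> \<and> U = generate G S)"

text \<open>In both classes \<open>\<kappa>\<close> is meant to be an infinite cardinal.\<close>

definition class_Z :: "'k rel \<Rightarrow> ('a, 'b) monoid_scheme \<Rightarrow> bool" where
  "class_Z \<kappa> G \<longleftrightarrow>
     group G \<and>
     (\<forall>U. generated_by_fewer G \<kappa> U \<longrightarrow> |rcosets\<^bsub>G\<^esub> (centralizer G U)| <o \<kappa>)"

definition class_Y :: "'k rel \<Rightarrow> ('a, 'b) monoid_scheme \<Rightarrow> bool" where
  "class_Y \<kappa> G \<longleftrightarrow>
     group G \<and>
     (\<forall>U. generated_by_fewer G \<kappa> U \<longrightarrow> |rcosets\<^bsub>G\<^esub> (normalizer G U)| <o \<kappa>)"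

section \<open>Trees\<close>

text \<open>A tree is given by a set \<open>T\<close> and a reflexive partial order \<open>r\<close> on it; the predecessors
  of \<open>x\<close> are the elements strictly below \<open>x\<close>.\<close>

definition pred_order :: "'a rel \<Rightarrow> 'a \<Rightarrow> 'a rel" where
  "pred_order r x = Restr r (underS r x)"

definition is_tree :: "'a set \<Rightarrow> 'a rel \<Rightarrow> bool" where
  "is_tree T r \<longleftrightarrow>
     partial_order_on T r \<and> (\<forall>x\<in>T. well_order_on (underS r x) (pred_order r x))"

definition tree_level :: "'a set \<Rightarrow> 'a rel \<Rightarrow> 'o rel \<Rightarrow> 'a set" where
  "tree_level T r \<alpha> = {x \<in> T. pred_order r x =o \<alpha>}"

text \<open>The height is the least ordinal whose level is empty. Letting \<open>\<beta>\<close> range over the type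
  of \<open>\<alpha>\<close> loses nothing, as every ordinal below \<open>\<alpha>\<close> is isomorphic to an initial segment of \<open>\<alpha>\<close>.\<close>

definition has_height :: "'a set \<Rightarrow> 'a rel \<Rightarrow> 'o rel \<Rightarrow> bool" where
  "has_height T r \<alpha> \<longleftrightarrow>
     Well_order \<alpha> \<and> tree_level T r \<alpha> = {} \<and>
     (\<forall>\<beta> :: 'o rel. \<beta> <o \<alpha> \<longrightarrow> tree_level T r \<beta> \<noteq> {})"

definition tree_branch :: "'a set \<Rightarrow> 'a rel \<Rightarrow> 'a set \<Rightarrow> bool" where
  "tree_branch T r B \<longleftrightarrow>
     B \<subseteq> T \<and> B \<in> Chains r \<and> (\<forall>C. C \<subseteq> T \<and> C \<in> Chains r \<and> B \<subseteq> C \<longrightarrow> C = B)"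

definition weak_Kurepa_tree :: "'a set \<Rightarrow> 'a rel \<Rightarrow> bool" where
  "weak_Kurepa_tree T r \<longleftrightarrow>
     is_tree T r \<and>
     has_height T r \<omega>\<^sub>1 \<and>
     \<omega>\<^sub>2 \<le>o |{B. tree_branch T r B \<and> \<not> countable B}| \<and>
     (\<forall>\<alpha> :: nat set rel. \<alpha> <o \<omega>\<^sub>1 \<longrightarrow> |tree_level T r \<alpha>| \<le>o \<omega>\<^sub>1)"

text \<open>A weak Kurepa tree has at most \<open>\<omega>\<^sub>1\<close> elements, and the field of \<open>\<omega>\<^sub>1\<close> is a set of
  elements of type \<^typ>\<open>nat set\<close>. So every weak Kurepa tree, on whatever type, has an isomorphic
  copy on \<^typ>\<open>nat set\<close>, and existence of such a tree can be stated there without loss.\<close>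

end

theory Submission
  imports Defs "HOL-Library.Countable_Set_Type"
begin

text \<open>
  Commutators of \<open>E\<close> lie in the centre \<open>Z\<close> of order \<open>p\<close>, so an element normalizing a subgroup
  \<open>W\<close> with \<open>W \<inter> Z = 1\<close> centralizes it; hence class \<open>Y\<close> bounds \<open>[E : C(W)]\<close> by \<open>\<omega>\<^sub>1\<close> for such
  \<open>W\<close>. A countable set of commuting elements is, up to \<open>Z\<close> and one further element, contained
  in such a \<open>W\<close>, and a Gram-Schmidt process for the commutator form puts every countable set,
  up to \<open>Z\<close>, into the group generated by two countable sets of commuting elements. Hence
  \<open>[E : C(S)] \<le> \<omega>\<^sub>1\<close> for every countable \<open>S\<close>. If \<open>E\<close> is not in class \<open>Z\<close>, pick \<open>S = {s\<^sub>\<alpha> | \<alpha> < \<omega>\<^sub>1}\<close>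
  with \<open>[E : C(S)] \<ge> \<omega>\<^sub>2\<close>. The functions \<open>\<alpha> \<mapsto> g\<inverse> s\<^sub>\<alpha> g\<close> for \<open>g \<in> E\<close> are at least \<open>\<omega>\<^sub>2\<close> many,
  while their restrictions to a countable initial segment are at most \<open>\<omega>\<^sub>1\<close> many, so the tree of
  these restrictions is a weak Kurepa tree.
\<close>

section \<open>The tree of restrictions of a family of functions\<close>

lemma Card_order_omega1: "Card_order \<omega>\<^sub>1"
  unfolding omega1_def by (rule cardSuc_Card_order[OF natLeq_Card_order])

lemma Card_order_omega2: "Card_order \<omega>\<^sub>2"
  unfolding omega2_def by (rule cardSuc_Card_order[OF Card_order_omega1])

lemma Well_order_omega1: "Well_order \<omega>\<^sub>1"
  using Card_order_omega1 card_order_on_def by blast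

lemma ordLess_omega1_iff: "|A| <o \<omega>\<^sub>1 \<longleftrightarrow> countable A"
  unfolding omega1_def countable_card_le_natLeq
  by (rule cardSuc_ordLeq_ordLess[OF natLeq_Card_order card_of_Card_order])

lemma ordLess_omega2_iff: "|A| <o \<omega>\<^sub>2 \<longleftrightarrow> |A| \<le>o \<omega>\<^sub>1"
  unfolding omega2_def
  by (rule cardSuc_ordLeq_ordLess[OF Card_order_omega1 card_of_Card_order])

lemma omega2_ordLeq_iff: "\<omega>\<^sub>2 \<le>o |A| \<longleftrightarrow> \<not> |A| \<le>o \<omega>\<^sub>1"
  using ordLess_omega2_iff[of A] Card_order_omega2 card_of_Well_order
  by (metis card_order_on_def not_ordLess_iff_ordLeq)

lemma countable_ordLeq_omega1: "countable A \<Longrightarrow> |A| \<le>o \<omega>\<^sub>1"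
  using ordLess_omega1_iff ordLess_imp_ordLeq by blast

lemma uncountable_Field_omega1: "uncountable (Field \<omega>\<^sub>1)"
proof -
  have "|Field \<omega>\<^sub>1| =o \<omega>\<^sub>1"
    by (rule card_of_Field_ordIso[OF Card_order_omega1])
  then show ?thesis
    using ordLess_omega1_iff not_ordLess_ordIso by blast
qed

lemma infinite_Field_omega1: "infinite (Field \<omega>\<^sub>1)"
  using uncountable_Field_omega1 countable_finite by blast

lemma countable_under_omega1:
  assumes "\<alpha> \<in> Field \<omega>\<^sub>1" shows "countable (under \<omega>\<^sub>1 \<alpha>)"
proof -
  have "|underS \<omega>\<^sub>1 \<alpha>| <o \<omega>\<^sub>1"
    by (rule card_of_underS[OF Card_order_omega1 assms])
  moreover have "under \<omega>\<^sub>1 \<alpha> \<subseteq> insert \<alpha> (underS \<omega>\<^sub>1 \<alpha>)"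
    by (auto simp: under_def underS_def)
  ultimately show ?thesis
    using countable_subset[OF _ countable_insert] by (auto simp: ordLess_omega1_iff)
qed

lemma UN_ordLeq_omega1:
  assumes "|I| \<le>o \<omega>\<^sub>1" "\<And>i. i \<in> I \<Longrightarrow> |A i| \<le>o \<omega>\<^sub>1"
  shows "|\<Union>i\<in>I. A i| \<le>o \<omega>\<^sub>1"
  using card_of_UNION_ordLeq_infinite_Field[OF infinite_Field_omega1 Card_order_omega1 assms(1)] assms(2)
  by blast

lemma Times_ordLeq_omega1:
  assumes "|A| \<le>o \<omega>\<^sub>1" "|B| \<le>o \<omega>\<^sub>1"
  shows "|A \<times> B| \<le>o \<omega>\<^sub>1"
  using card_of_Times_ordLeq_infinite_Field[OF infinite_Field_omega1 assms Card_order_omega1] .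

text \<open>The nodes at index \<alpha> are the restrictions of members of \<open>F\<close> to the
  initial segment ending at \<alpha>, ordered by extension. The bound \<open>few\<close> controls
  the levels; each function in \<open>F\<close> yields the branch of all its restrictions, and
  \<open>many\<close> counts these branches.\<close>

lemma weak_Kurepa_tree_from_functions:
  fixes F :: "(nat set \<Rightarrow> 'c) set"
  assumes ext: "F \<subseteq> extensional (Field \<omega>\<^sub>1)"
    and many: "\<omega>\<^sub>2 \<le>o |F|"
    and few: "\<And>\<alpha>. \<alpha> \<in> Field \<omega>\<^sub>1 \<Longrightarrow> |(\<lambda>f. restrict f (under \<omega>\<^sub>1 \<alpha>)) ` F| \<le>o \<omega>\<^sub>1"
  shows "\<exists>(T :: nat set set) (r :: nat set rel). weak_Kurepa_tree T r"
proof -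
  let ?w = "\<omega>\<^sub>1" and ?O = "Field \<omega>\<^sub>1"
  interpret w: wo_rel ?w
    using Well_order_omega1 by (simp add: wo_rel_def)
  have refl: "(a, a) \<in> ?w" if "a \<in> ?O" for a
    using w.REFL that by (auto simp: refl_on_def)
  have trans: "(a, c) \<in> ?w" if "(a, b) \<in> ?w" "(b, c) \<in> ?w" for a b c
    using w.TRANS that by (meson transD)
  have antisym: "a = b" if "(a, b) \<in> ?w" "(b, a) \<in> ?w" for a b
    using w.ANTISYM that by (meson antisymD)
  have fld: "a \<in> ?O" "b \<in> ?O" if "(a, b) \<in> ?w" for a b
    using that by (auto simp: Field_def)
  have total: "(a, b) \<in> ?w \<or> (b, a) \<in> ?w" if "a \<in> ?O" "b \<in> ?O" for a b
    using w.TOTALS that by blast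
  have wO: "|?O| \<le>o ?w"
    using card_of_Field_ordIso[OF Card_order_omega1] ordIso_imp_ordLeq by blast
  \<comment> \<open>The nodes record restrictions to \<open>under\<close>, not \<open>underS\<close>, so that two functions differing at \<open>\<alpha>\<close>
    are separated by their nodes at \<open>\<alpha>\<close>. The order still has predecessors indexed by \<open>underS\<close>.\<close>
  define T0 where "T0 = (\<Union>\<alpha>\<in>?O. Pair \<alpha> ` (\<lambda>f. restrict f (under ?w \<alpha>)) ` F)"
  have "|T0| \<le>o ?w"
    unfolding T0_def
    using few by (intro UN_ordLeq_omega1[OF wO]) (rule ordLeq_transitive[OF card_of_image])
  then have "|T0| \<le>o |?O|"
    using card_of_Field_ordIso[OF Card_order_omega1] ordIso_symmetric ordLeq_ordIso_trans by blast
  \<comment> \<open>The coding \<open>e\<close> moves the nodes into the type \<open>nat set\<close>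
    demanded by the conclusion; the field of \<open>\<omega>\<^sub>1\<close> consists of elements of
    this type and is large enough.\<close>
  then obtain e :: "_ \<Rightarrow> nat set" where e: "inj_on e T0"
    using card_of_ordLeq[of T0 ?O] by blast
  define N where "N \<alpha> f = e (\<alpha>, restrict f (under ?w \<alpha>))" for \<alpha> f
  \<comment> \<open>From here on nodes are compared through \<open>agree\<close> alone:
    \<open>N_eq\<close> and \<open>r_iff\<close> hide both the coding and the restrictions.\<close>
  define agree where "agree \<alpha> f g \<longleftrightarrow> (\<forall>\<gamma>. (\<gamma>, \<alpha>) \<in> ?w \<longrightarrow> f \<gamma> = g \<gamma>)" for \<alpha> and f g :: "nat set \<Rightarrow> 'c"
  have agree_restrict: "restrict f (under ?w \<alpha>) = restrict g (under ?w \<alpha>) \<longleftrightarrow> agree \<alpha> f g" for \<alpha> f g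
    unfolding agree_def by (auto simp: fun_eq_iff restrict_def under_def)
  have N_eq: "N \<alpha> f = N \<beta> g \<longleftrightarrow> \<alpha> = \<beta> \<and> agree \<alpha> f g"
    if "\<alpha> \<in> ?O" "\<beta> \<in> ?O" "f \<in> F" "g \<in> F" for \<alpha> \<beta> f g
  proof -
    have "(\<alpha>, restrict f (under ?w \<alpha>)) \<in> T0" "(\<beta>, restrict g (under ?w \<beta>)) \<in> T0"
      using that by (auto simp: T0_def)
    then have "N \<alpha> f = N \<beta> g \<longleftrightarrow> \<alpha> = \<beta> \<and> restrict f (under ?w \<alpha>) = restrict g (under ?w \<beta>)"
      unfolding N_def using e by (auto dest: inj_onD)
    then show ?thesis using agree_restrict by blast
  qed
  have agree_mono: "agree \<beta> f g" if "agree \<alpha> f g" "(\<beta>, \<alpha>) \<in> ?w" for \<alpha> \<beta> f g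
    using that trans unfolding agree_def by blast
  have agree_refl: "agree \<alpha> f f" for \<alpha> f by (simp add: agree_def)
  have agree_sym: "agree \<alpha> f g \<Longrightarrow> agree \<alpha> g f" for \<alpha> f g by (simp add: agree_def)
  have agree_trans: "agree \<alpha> f g \<Longrightarrow> agree \<alpha> g h \<Longrightarrow> agree \<alpha> f h" for \<alpha> f g h by (simp add: agree_def)
  define T where "T = {N \<alpha> f | \<alpha> f. \<alpha> \<in> ?O \<and> f \<in> F}"
  \<comment> \<open>A single \<open>f\<close> witnesses that the upper node extends the lower one;
    \<open>r_iff\<close> shows that the relation does not depend on the functions chosen to
    represent the nodes.\<close>
  define r where "r = {(N \<alpha> f, N \<beta> f) | \<alpha> \<beta> f. (\<alpha>, \<beta>) \<in> ?w \<and> f \<in> F}"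
  have r_iff: "(N \<alpha> f, N \<beta> g) \<in> r \<longleftrightarrow> (\<alpha>, \<beta>) \<in> ?w \<and> agree \<alpha> f g"
    if "\<alpha> \<in> ?O" "\<beta> \<in> ?O" "f \<in> F" "g \<in> F" for \<alpha> \<beta> f g
  proof
    assume "(N \<alpha> f, N \<beta> g) \<in> r"
    then obtain a b h where h: "N \<alpha> f = N a h" "N \<beta> g = N b h" "(a, b) \<in> ?w" "h \<in> F"
      unfolding r_def by auto
    then have "\<alpha> = a" "agree \<alpha> f h" "\<beta> = b" "agree \<beta> g h"
      using that fld N_eq by metis+
    then show "(\<alpha>, \<beta>) \<in> ?w \<and> agree \<alpha> f g"
      using h agree_mono agree_sym agree_trans by meson
  next
    assume *: "(\<alpha>, \<beta>) \<in> ?w \<and> agree \<alpha> f g"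
    then have "N \<alpha> f = N \<alpha> g" using N_eq that by blast
    then show "(N \<alpha> f, N \<beta> g) \<in> r" unfolding r_def using * that by auto
  qed
  have T_E: "\<exists>\<alpha> f. x = N \<alpha> f \<and> \<alpha> \<in> ?O \<and> f \<in> F" if "x \<in> T" for x
    using that by (auto simp: T_def)
  have NT: "N \<alpha> f \<in> T" if "\<alpha> \<in> ?O" "f \<in> F" for \<alpha> f using that by (auto simp: T_def)
  have rT: "x \<in> T \<and> y \<in> T" if "(x, y) \<in> r" for x y
    using that fld NT unfolding r_def by blast
  have po: "partial_order_on T r"
    unfolding partial_order_on_def preorder_on_def
  proof (intro conjI)
    show "r \<subseteq> T \<times> T" using rT by auto
    show "refl_on T r"
      using r_iff agree_refl refl by (auto simp: refl_on_def T_def)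
    show "trans r"
    proof (rule transI)
      fix x y z assume xy: "(x, y) \<in> r" and yz: "(y, z) \<in> r"
      obtain a f where x: "x = N a f" "a \<in> ?O" "f \<in> F" using rT[OF xy] T_E by blast
      obtain b g where y: "y = N b g" "b \<in> ?O" "g \<in> F" using rT[OF yz] T_E by blast
      obtain c h where z: "z = N c h" "c \<in> ?O" "h \<in> F" using rT[OF yz] T_E by blast
      have "(a, b) \<in> ?w" "agree a f g" "(b, c) \<in> ?w" "agree b g h"
        using xy yz r_iff x y z by auto
      then have "(a, c) \<in> ?w" "agree a f h"
        using trans agree_mono agree_trans by blast+
      then show "(x, z) \<in> r" using r_iff x z by auto
    qed
    show "antisym r"
    proof (rule antisymI)
      fix x y assume xy: "(x, y) \<in> r" and yx: "(y, x) \<in> r"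
      obtain a f where x: "x = N a f" "a \<in> ?O" "f \<in> F" using rT[OF xy] T_E by blast
      obtain b g where y: "y = N b g" "b \<in> ?O" "g \<in> F" using rT[OF xy] T_E by blast
      have "(a, b) \<in> ?w" "agree a f g" "(b, a) \<in> ?w"
        using xy yx r_iff x y by auto
      then show "x = y" using antisym N_eq x y by auto
    qed
  qed
  have uF: "underS ?w \<alpha> \<subseteq> ?O" for \<alpha>
    by (auto simp: underS_def Field_def)
  \<comment> \<open>\<open>W \<alpha>\<close> is the ordinal represented by \<alpha>. Below
    \<open>N \<alpha> f\<close> there is exactly one node for each smaller index, so the
    predecessors of that node have order type \<open>W \<alpha>\<close>, whatever \<open>f\<close>
    is.\<close>
  define W where "W \<alpha> = Restr ?w (underS ?w \<alpha>)" for \<alpha>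
  have W_wo: "Well_order (W \<alpha>)" for \<alpha>
    unfolding W_def using Well_order_Restr[OF Well_order_omega1] .
  have W_Field: "Field (W \<alpha>) = underS ?w \<alpha>" for \<alpha>
    unfolding W_def by (rule Refl_Field_Restr2[OF w.REFL uF])
  have underS_N: "underS r (N \<alpha> f) = (\<lambda>\<beta>. N \<beta> f) ` underS ?w \<alpha>"
    if a: "\<alpha> \<in> ?O" "f \<in> F" for \<alpha> f
  proof (intro equalityI subsetI)
    fix x assume "x \<in> underS r (N \<alpha> f)"
    then have x: "x \<noteq> N \<alpha> f" "(x, N \<alpha> f) \<in> r" by (auto simp: underS_def)
    then obtain b g where y: "x = N b g" "b \<in> ?O" "g \<in> F" using rT T_E by blast
    then have b: "(b, \<alpha>) \<in> ?w" "agree b g f" using x r_iff a by auto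
    then have "x = N b f" using y a N_eq by auto
    moreover have "b \<in> underS ?w \<alpha>"
      using b x y calculation by (auto simp: underS_def)
    ultimately show "x \<in> (\<lambda>\<beta>. N \<beta> f) ` underS ?w \<alpha>" by blast
  next
    fix x assume "x \<in> (\<lambda>\<beta>. N \<beta> f) ` underS ?w \<alpha>"
    then obtain b where b: "x = N b f" "b \<noteq> \<alpha>" "(b, \<alpha>) \<in> ?w" by (auto simp: underS_def)
    then have "b \<in> ?O" using fld by blast
    then show "x \<in> underS r (N \<alpha> f)"
      using b a r_iff N_eq agree_refl by (auto simp: underS_def)
  qed
  have pred_N: "pred_order r (N \<alpha> f) = dir_image (W \<alpha>) (\<lambda>\<beta>. N \<beta> f)"
    if a: "\<alpha> \<in> ?O" "f \<in> F" for \<alpha> f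
  proof -
    have "(x, y) \<in> pred_order r (N \<alpha> f) \<longleftrightarrow> (x, y) \<in> dir_image (W \<alpha>) (\<lambda>\<beta>. N \<beta> f)" for x y
    proof
      assume "(x, y) \<in> pred_order r (N \<alpha> f)"
      then have "x \<in> (\<lambda>\<beta>. N \<beta> f) ` underS ?w \<alpha>" "y \<in> (\<lambda>\<beta>. N \<beta> f) ` underS ?w \<alpha>" and xy: "(x, y) \<in> r"
        using underS_N[OF a] by (auto simp: pred_order_def)
      then obtain b c where bc: "x = N b f" "b \<in> underS ?w \<alpha>" "y = N c f" "c \<in> underS ?w \<alpha>" by auto
      then have "b \<in> ?O" "c \<in> ?O" using uF by blast+
      then have "(b, c) \<in> ?w" using xy r_iff a bc by auto
      then show "(x, y) \<in> dir_image (W \<alpha>) (\<lambda>\<beta>. N \<beta> f)"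
        using bc unfolding dir_image_def W_def by blast
    next
      assume "(x, y) \<in> dir_image (W \<alpha>) (\<lambda>\<beta>. N \<beta> f)"
      then obtain b c where bc: "x = N b f" "b \<in> underS ?w \<alpha>" "y = N c f" "c \<in> underS ?w \<alpha>" "(b, c) \<in> ?w"
        unfolding dir_image_def W_def by auto
      then have "(x, y) \<in> r" unfolding r_def using a by blast
      then show "(x, y) \<in> pred_order r (N \<alpha> f)"
        using underS_N[OF a] bc by (auto simp: pred_order_def)
    qed
    then show ?thesis by auto
  qed
  have inj_N: "inj_on (\<lambda>\<beta>. N \<beta> f) A" if "f \<in> F" "A \<subseteq> ?O" for f A
    using N_eq that by (auto simp: inj_on_def subset_iff)
  have pred_iso: "W \<alpha> =o pred_order r (N \<alpha> f)" if a: "\<alpha> \<in> ?O" "f \<in> F" for \<alpha> f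
    unfolding pred_N[OF a] 
    by (rule dir_image_ordIso[OF W_wo]) (use inj_N[OF a(2)] W_Field uF in auto)
  have tree: "is_tree T r"
    unfolding is_tree_def
  proof (intro conjI po ballI)
    fix x assume "x \<in> T"
    then obtain \<alpha> f where a: "x = N \<alpha> f" "\<alpha> \<in> ?O" "f \<in> F" using T_E by blast
    have "Well_order (pred_order r x)"
      unfolding a(1) pred_N[OF a(2,3)]
      by (rule Well_order_dir_image[OF W_wo]) (use inj_N[OF a(3)] W_Field uF in auto)
    moreover have "Field (pred_order r x) = underS r x"
      unfolding a(1) underS_N[OF a(2,3)] pred_N[OF a(2,3)] dir_image_Field W_Field ..
    ultimately show "well_order_on (underS r x) (pred_order r x)" by simp
  qed
  have W_less: "W \<alpha> <o ?w" if "\<alpha> \<in> ?O" for \<alpha>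
    unfolding W_def using underS_Restr_ordLess[OF Well_order_omega1] that by blast
  have "F \<noteq> {}"
    using many omega2_ordLeq_iff countable_ordLeq_omega1 countable_empty by blast
  then obtain f0 where f0: "f0 \<in> F" by blast
  have height: "has_height T r ?w"
    unfolding has_height_def
  proof (intro conjI Well_order_omega1 allI impI)
    have "\<not> pred_order r x =o ?w" if "x \<in> T" for x
    proof -
      obtain \<alpha> f where a: "x = N \<alpha> f" "\<alpha> \<in> ?O" "f \<in> F" using T_E \<open>x \<in> T\<close> by blast
      then show ?thesis
        using pred_iso[OF a(2,3)] W_less[OF a(2)] ordIso_transitive not_ordLess_ordIso by blast
    qed
    then show "tree_level T r ?w = {}" by (auto simp: tree_level_def)
    fix \<beta> :: "nat set rel" assume "\<beta> <o ?w"
    then obtain \<alpha> where a: "\<alpha> \<in> ?O" "\<beta> =o W \<alpha>"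
      unfolding W_def using ordLess_iff_ordIso_Restr[OF Well_order_omega1]
      by (metis ordLess_Well_order_simp)
    then have "pred_order r (N \<alpha> f0) =o \<beta>"
      using pred_iso[OF a(1) f0] ordIso_symmetric ordIso_transitive by blast
    then show "tree_level T r \<beta> \<noteq> {}"
      using NT[OF a(1) f0] by (auto simp: tree_level_def)
  qed
  \<comment> \<open>A proper initial segment of a well-order is strictly shorter, so the order type
    of its predecessors determines the index of a node.\<close>
  have W_inj: "\<alpha> = \<beta>" if "\<alpha> \<in> ?O" "\<beta> \<in> ?O" "W \<alpha> =o W \<beta>" for \<alpha> \<beta>
  proof -
    have *: "W a <o W b" if "(a, b) \<in> ?w" "a \<noteq> b" for a b
    proof -
      have "a \<in> underS ?w b" "a \<notin> underS ?w a"
        using that by (auto simp: underS_def)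
      moreover have "underS ?w a \<subseteq> underS ?w b"
        unfolding underS_def using that trans antisym by blast
      ultimately have "underS ?w a \<subset> underS ?w b" by blast
      then show ?thesis
        unfolding W_def
        using w.underS_ofilter ofilter_subset_ordLess[OF Well_order_omega1] by blast
    qed
    then show ?thesis using total[OF that(1,2)] that(3) not_ordLess_ordIso ordIso_symmetric by blast
  qed
  have levels: "|tree_level T r \<gamma>| \<le>o ?w" for \<gamma> :: "nat set rel"
  proof (cases "tree_level T r \<gamma> = {}")
    case True
    then show ?thesis by (simp add: countable_ordLeq_omega1)
  next
    case False
    then obtain \<alpha> f where a: "\<alpha> \<in> ?O" "f \<in> F" "pred_order r (N \<alpha> f) =o \<gamma>"
      using T_E unfolding tree_level_def by blast
    \<comment> \<open>All nodes of a nonempty level share one index \<alpha>, so the level is an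
      image of the restrictions counted by \<open>few\<close>.\<close>
    have "tree_level T r \<gamma> \<subseteq> (\<lambda>u. e (\<alpha>, u)) ` (\<lambda>f. restrict f (under ?w \<alpha>)) ` F"
    proof
      fix x assume x: "x \<in> tree_level T r \<gamma>"
      then obtain \<beta> g where b: "x = N \<beta> g" "\<beta> \<in> ?O" "g \<in> F" "pred_order r (N \<beta> g) =o \<gamma>"
        using T_E unfolding tree_level_def by blast
      then have "W \<alpha> =o W \<beta>"
        using pred_iso[OF a(1,2)] pred_iso[OF b(2,3)] a(3) ordIso_symmetric ordIso_transitive by blast
      then have "\<alpha> = \<beta>" using W_inj a b by blast
      then show "x \<in> (\<lambda>u. e (\<alpha>, u)) ` (\<lambda>f. restrict f (under ?w \<alpha>)) ` F"
        using b by (auto simp: N_def)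
    qed
    then show ?thesis
      using card_of_mono1 card_of_image few[OF a(1)] ordLeq_transitive by meson
  qed
  define B where "B f = (\<lambda>\<alpha>. N \<alpha> f) ` ?O" for f
  have B_branch: "tree_branch T r (B f)" if f: "f \<in> F" for f
    unfolding tree_branch_def
  proof (intro conjI allI impI)
    show "B f \<subseteq> T" using NT f by (auto simp: B_def)
    show "B f \<in> Chains r"
      unfolding Chains_def B_def using total r_iff agree_refl f by blast
    fix C assume C: "C \<subseteq> T \<and> C \<in> Chains r \<and> B f \<subseteq> C"
    have "x \<in> B f" if x: "x \<in> C" for x
    proof -
      obtain \<alpha> g where a: "x = N \<alpha> g" "\<alpha> \<in> ?O" "g \<in> F" using T_E C x by blast
      \<comment> \<open>Maximality: the larger chain contains two nodes of the same index \<alpha>,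
        and comparable nodes of equal index coincide.\<close>
      have "N \<alpha> f \<in> C" using C a by (auto simp: B_def)
      then have "(x, N \<alpha> f) \<in> r \<or> (N \<alpha> f, x) \<in> r" using C x unfolding Chains_def by blast
      then have "agree \<alpha> g f" using a f r_iff agree_sym by blast
      then have "x = N \<alpha> f" using N_eq a f by blast
      then show ?thesis using a by (auto simp: B_def)
    qed
    then show "C = B f" using C by blast
  qed
  have B_unc: "uncountable (B f)" if "f \<in> F" for f
    unfolding B_def using uncountable_Field_omega1 countable_image_inj_on[OF _ inj_N[OF that order_refl]] by blast
  have "inj_on B F"
  proof (rule inj_onI)
    fix f g assume fg: "f \<in> F" "g \<in> F" "B f = B g"
    show "f = g"
    \<comment> \<open>Equal branches give agreement only on the field of
      \<open>\<omega>\<^sub>1\<close>; \<open>ext\<close> fixes the values elsewhere.\<close>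
    proof (rule extensionalityI)
      show "f \<in> extensional ?O" "g \<in> extensional ?O" using ext fg by auto
      fix \<alpha> assume a: "\<alpha> \<in> ?O"
      then have "N \<alpha> f \<in> B g" using fg by (auto simp: B_def)
      then obtain \<beta> where "\<beta> \<in> ?O" "N \<alpha> f = N \<beta> g" by (auto simp: B_def)
      then have "agree \<alpha> f g" using N_eq a fg by blast
      then show "f \<alpha> = g \<alpha>" using refl[OF a] by (auto simp: agree_def)
    qed
  qed
  then have "|F| \<le>o |{B. tree_branch T r B \<and> \<not> countable B}|"
    using B_branch B_unc by (intro card_of_ordLeqI[of B]) auto
  then have "\<omega>\<^sub>2 \<le>o |{B. tree_branch T r B \<and> \<not> countable B}|"
    using many ordLeq_transitive by blast
  then show ?thesis
    using tree height levels unfolding weak_Kurepa_tree_def by blast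
qed

section \<open>Centralizers\<close>

text \<open>For \<kappa> = \<open>\<omega>\<^sub>2\<close> this is the index condition "less than
  \<kappa>" of both classes, by \<open>ordLess_omega2_iff\<close>.\<close>

abbreviation index_le_omega1 :: "('a, 'b) monoid_scheme \<Rightarrow> 'a set \<Rightarrow> bool" where
  "index_le_omega1 G H \<equiv> |rcosets\<^bsub>G\<^esub> H| \<le>o \<omega>\<^sub>1"

context group
begin

section \<open>Centralizers of sets and of the subgroups they generate\<close>

lemma centralizer_subset: "centralizer G S \<subseteq> carrier G"
  by (auto simp: centralizer_def)

lemma centralizer_antimono: "S \<subseteq> T \<Longrightarrow> centralizer G T \<subseteq> centralizer G S"
  by (auto simp: centralizer_def)

lemma centralizer_Un: "centralizer G (S \<union> T) = centralizer G S \<inter> centralizer G T"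
  by (auto simp: centralizer_def)

lemma centralizerD: "g \<in> centralizer G S \<Longrightarrow> s \<in> S \<Longrightarrow> g \<otimes> s = s \<otimes> g"
  by (auto simp: centralizer_def)

lemma centralizer_subgroup:
  assumes "S \<subseteq> carrier G" shows "subgroup (centralizer G S) G"
proof (rule subgroupI)
  show "centralizer G S \<subseteq> carrier G" by (rule centralizer_subset)
  show "centralizer G S \<noteq> {}"
    using assms by (auto simp: centralizer_def intro!: exI[of _ \<one>])
  fix a assume a: "a \<in> centralizer G S"
  show "inv a \<in> centralizer G S"
    unfolding centralizer_def
  proof (intro CollectI conjI ballI)
    show "inv a \<in> carrier G" using a by (simp add: centralizer_def)
    fix u assume "u \<in> S"
    then have u: "u \<in> carrier G" "a \<in> carrier G" "a \<otimes> u = u \<otimes> a"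
      using a assms by (auto simp: centralizer_def)
    have "inv a \<otimes> u = inv a \<otimes> (u \<otimes> a) \<otimes> inv a"
      using u(1,2) by (simp add: m_assoc)
    also have "\<dots> = inv a \<otimes> (a \<otimes> u) \<otimes> inv a" using u by simp
    also have "\<dots> = u \<otimes> inv a"
      using u(1,2) by (simp add: m_assoc[symmetric])
    finally show "inv a \<otimes> u = u \<otimes> inv a" .
  qed
next
  fix a b assume a: "a \<in> centralizer G S" and b: "b \<in> centralizer G S"
  show "a \<otimes> b \<in> centralizer G S"
    unfolding centralizer_def
  proof (intro CollectI conjI ballI)
    show "a \<otimes> b \<in> carrier G" using a b by (simp add: centralizer_def)
    fix u assume "u \<in> S"
    then have u: "u \<in> carrier G" "a \<in> carrier G" "b \<in> carrier G" "a \<otimes> u = u \<otimes> a" "b \<otimes> u = u \<otimes> b"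
      using a b assms by (auto simp: centralizer_def)
    then show "a \<otimes> b \<otimes> u = u \<otimes> (a \<otimes> b)"
      by (metis m_assoc)
  qed
qed

lemma subset_centralizer_swap:
  assumes "S \<subseteq> carrier G" "T \<subseteq> centralizer G S"
  shows "S \<subseteq> centralizer G T"
  using assms by (auto simp: centralizer_def subset_iff)

text \<open>\<open>S\<close> lies in its double centralizer, which is a subgroup and so contains
  everything that \<open>S\<close> generates. This allows passing between a subgroup and its
  generators in the two class conditions.\<close>

lemma centralizer_generate:
  assumes "S \<subseteq> carrier G"
  shows "centralizer G (generate G S) = centralizer G S"
proof
  show "centralizer G (generate G S) \<subseteq> centralizer G S"
    by (rule centralizer_antimono) (auto intro: generate.incl)
  have "S \<subseteq> centralizer G (centralizer G S)"
    using assms by (rule subset_centralizer_swap) simp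
  then have "generate G S \<subseteq> centralizer G (centralizer G S)"
    by (rule generate_subgroup_incl) (rule centralizer_subgroup[OF centralizer_subset])
  then show "centralizer G S \<subseteq> centralizer G (generate G S)"
    by (rule subset_centralizer_swap[OF centralizer_subset])
qed

lemma commute_generate:
  assumes "S \<subseteq> carrier G" "g \<in> centralizer G S" "s \<in> generate G S"
  shows "g \<otimes> s = s \<otimes> g"
  using assms centralizer_generate centralizerD by blast

section \<open>Comparing indices by counting values of functions\<close>

lemma rcos_eq_iff:
  assumes "subgroup H G" "g \<in> carrier G" "h \<in> carrier G"
  shows "H #> g = H #> h \<longleftrightarrow> g \<otimes> inv h \<in> H"
proof
  assume "H #> g = H #> h"
  then have "g \<in> H #> h" using rcos_self assms by blast
  then obtain k where "k \<in> H" "g = k \<otimes> h" by (auto simp: r_coset_def)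
  then show "g \<otimes> inv h \<in> H"
    using assms subgroup.mem_carrier[OF assms(1)] by (simp add: m_assoc)
next
  assume "g \<otimes> inv h \<in> H"
  moreover have "g = (g \<otimes> inv h) \<otimes> h" using assms by (simp add: m_assoc)
  ultimately have "g \<in> H #> h" unfolding r_coset_def by blast
  then show "H #> g = H #> h" using repr_independence assms by metis
qed

lemma rcosets_image: "rcosets H = (\<lambda>g. H #> g) ` carrier G"
  by (auto simp: RCOSETS_def)

text \<open>A value of \<open>f\<close> determines the coset, via any chosen preimage of that value,
  so there are at most as many cosets as values.\<close>

lemma card_of_rcosets_le:
  assumes "subgroup H G"
    and "\<And>g h. g \<in> carrier G \<Longrightarrow> h \<in> carrier G \<Longrightarrow> f g = f h \<Longrightarrow> g \<otimes> inv h \<in> H"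
  shows "|rcosets H| \<le>o |f ` carrier G|"
proof -
  have eq: "(\<lambda>g. H #> g) ` carrier G = (\<lambda>y. H #> (SOME g. g \<in> carrier G \<and> f g = y)) ` f ` carrier G"
  proof -
    have "H #> g = H #> (SOME h. h \<in> carrier G \<and> f h = f g)" if "g \<in> carrier G" for g
    proof -
      have "(SOME h. h \<in> carrier G \<and> f h = f g) \<in> carrier G \<and> f (SOME h. h \<in> carrier G \<and> f h = f g) = f g"
        using that by (intro someI[of "\<lambda>h. h \<in> carrier G \<and> f h = f g" g]) simp
      then show ?thesis using rcos_eq_iff[OF assms(1) that] assms(2)[OF that] by simp
    qed
    then show ?thesis unfolding image_image by (rule image_cong[OF refl])
  qed
  show ?thesis unfolding rcosets_image by (subst eq) (rule card_of_image)
qed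

text \<open>The converse count: when \<open>f\<close> is constant on cosets, a representative chosen
  in each coset recovers all values.\<close>

lemma card_of_image_le_rcosets:
  assumes "subgroup H G"
    and "\<And>g h. g \<in> carrier G \<Longrightarrow> h \<in> carrier G \<Longrightarrow> g \<otimes> inv h \<in> H \<Longrightarrow> f g = f h"
  shows "|f ` carrier G| \<le>o |rcosets H|"
proof -
  have "f g = f (SOME h. h \<in> carrier G \<and> H #> h = H #> g)" if "g \<in> carrier G" for g
  proof -
    have "(SOME h. h \<in> carrier G \<and> H #> h = H #> g) \<in> carrier G \<and> H #> (SOME h. h \<in> carrier G \<and> H #> h = H #> g) = H #> g"
      using that by (intro someI[of "\<lambda>h. h \<in> carrier G \<and> H #> h = H #> g" g]) simp
    then show ?thesis using rcos_eq_iff[OF assms(1) that] assms(2)[OF that] by auto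
  qed
  then have eq: "f ` carrier G = (\<lambda>y. f (SOME h. h \<in> carrier G \<and> H #> h = y)) ` (\<lambda>g. H #> g) ` carrier G"
    unfolding image_image by (rule image_cong[OF refl])
  show ?thesis unfolding rcosets_image by (subst eq) (rule card_of_image)
qed

lemma index_le_omega1_mono:
  assumes "index_le_omega1 G H" "H \<subseteq> K" "subgroup H G" "subgroup K G"
  shows "index_le_omega1 G K"
proof -
  have "|rcosets K| \<le>o |(\<lambda>g. H #> g) ` carrier G|"
    using assms rcos_eq_iff by (intro card_of_rcosets_le) auto
  then show ?thesis using assms(1) unfolding rcosets_image[of H] using ordLeq_transitive by blast
qed

lemma index_le_omega1_Int:
  assumes "index_le_omega1 G H" "index_le_omega1 G K" "subgroup H G" "subgroup K G"
  shows "index_le_omega1 G (H \<inter> K)"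
proof -
  let ?f = "\<lambda>g. (H #> g, K #> g)"
  have "|rcosets (H \<inter> K)| \<le>o |?f ` carrier G|"
    using assms(3,4) rcos_eq_iff by (intro card_of_rcosets_le subgroups_Inter_pair) auto
  also have "|?f ` carrier G| \<le>o |(rcosets H) \<times> (rcosets K)|"
    by (rule card_of_mono1) (auto simp: rcosets_image)
  also have "|(rcosets H) \<times> (rcosets K)| \<le>o \<omega>\<^sub>1"
    using assms(1,2) by (rule Times_ordLeq_omega1)
  finally show ?thesis .
qed

text \<open>Conjugation is written with the inverse on the left so that equality of conjugates
  becomes the right coset criterion of \<open>rcos_eq_iff\<close> for the centralizer of
  \<open>s\<close>.\<close>

lemma conj_eq_iff:
  assumes "g \<in> carrier G" "h \<in> carrier G" "s \<in> carrier G"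
  shows "inv g \<otimes> s \<otimes> g = inv h \<otimes> s \<otimes> h \<longleftrightarrow> (g \<otimes> inv h) \<otimes> s = s \<otimes> (g \<otimes> inv h)"
proof -
  have "inv g \<otimes> s \<otimes> g = inv h \<otimes> s \<otimes> h \<longleftrightarrow> g \<otimes> (inv g \<otimes> s \<otimes> g) \<otimes> inv h = g \<otimes> (inv h \<otimes> s \<otimes> h) \<otimes> inv h"
    using assms by simp
  also have "g \<otimes> (inv g \<otimes> s \<otimes> g) \<otimes> inv h = s \<otimes> (g \<otimes> inv h)"
    using assms by (simp add: m_assoc[symmetric])
  also have "g \<otimes> (inv h \<otimes> s \<otimes> h) \<otimes> inv h = (g \<otimes> inv h) \<otimes> s"
    using assms by (simp add: m_assoc)
  finally show ?thesis by auto
qed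

lemma normalizer_conj_closed:
  assumes "g \<in> normalizer G W" "W \<subseteq> carrier G" "w \<in> W"
  shows "g \<in> carrier G" "g \<otimes> w \<otimes> inv g \<in> W"
proof -
  show "g \<in> carrier G" using assms(1) by (simp add: normalizer_def stabilizer_def)
  have "g <# W #> inv g = W"
    using assms(1,2) by (simp add: normalizer_def stabilizer_def)
  moreover have "g \<otimes> w \<otimes> inv g \<in> g <# W #> inv g"
    using assms(3) by (auto simp: l_coset_def r_coset_def)
  ultimately show "g \<otimes> w \<otimes> inv g \<in> W" by simp
qed

text \<open>Since \<open>a\<close> commutes with all that \<open>S\<close> generates, its powers can
  be collected on the right; its finite order turns inverses into powers, so natural exponents
  suffice.\<close>

lemma generate_insert_commuting:
  assumes S: "S \<subseteq> carrier G" and a: "a \<in> centralizer G S" "a [^] n = \<one>" "n > (0::nat)"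
    and y: "y \<in> generate G (insert a S)"
  shows "\<exists>w\<in>generate G S. \<exists>i::nat. y = w \<otimes> a [^] i"
proof -
  have ac: "a \<in> carrier G" using a(1) by (simp add: centralizer_def)
  have pc: "a [^] (i::nat) \<otimes> w = w \<otimes> a [^] i" if "w \<in> generate G S" for w i
    using group_commutes_pow[OF commute_generate[OF S a(1) that] ac generate_in_carrier[OF S that]] .
  have inv_a: "inv a = a [^] (n - 1)"
  proof (rule inv_equality)
    show "a [^] (n - 1) \<otimes> a = \<one>"
      using a(2,3) nat_pow_Suc[of a "n - 1"] by simp
  qed (use ac in auto)
  show ?thesis
    using y
  proof (induction rule: generate.induct)
    case one
    then show ?case using generate.one[of G S] by (metis ac nat_pow_0 one_closed r_one)
  next
    case (incl h)
    then show ?case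
    proof
      assume "h = a"
      then show ?thesis using generate.one[of G S] ac by (metis l_one nat_pow_eone)
    next
      assume "h \<in> S"
      then show ?thesis using generate.incl[of h S G] S by (metis nat_pow_0 r_one subsetD)
    qed
  next
    case (inv h)
    then show ?case
    proof
      assume "h = a"
      then show ?thesis using generate.one[of G S] ac inv_a by (metis l_one nat_pow_closed)
    next
      assume "h \<in> S"
      then show ?thesis
        using generate.inv[of h S G] S by (metis nat_pow_0 r_one subsetD inv_closed)
    qed
  next
    case (eng h1 h2)
    then obtain w1 w2 and i1 i2 :: nat where
      w: "w1 \<in> generate G S" "w2 \<in> generate G S" "h1 = w1 \<otimes> a [^] i1" "h2 = w2 \<otimes> a [^] i2" by blast
    have c: "w1 \<in> carrier G" "w2 \<in> carrier G" using w S generate_in_carrier by auto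
    have "h1 \<otimes> h2 = w1 \<otimes> (a [^] i1 \<otimes> w2) \<otimes> a [^] i2"
      using w c ac by (simp add: m_assoc)
    also have "\<dots> = w1 \<otimes> (w2 \<otimes> a [^] i1) \<otimes> a [^] i2" using pc w by simp
    also have "\<dots> = w1 \<otimes> w2 \<otimes> a [^] (i1 + i2)"
      using c ac by (simp add: m_assoc nat_pow_mult[symmetric])
    finally show ?case using generate.eng[OF w(1,2)] by blast
  qed
qed

text \<open>An element of a generated subgroup uses finitely many generators, and these lie in one
  member of the chain. This supplies the upper bounds for Zorn's lemma.\<close>

lemma generate_Union_chain:
  assumes "\<C> \<noteq> {}" "\<And>S T. S \<in> \<C> \<Longrightarrow> T \<in> \<C> \<Longrightarrow> S \<subseteq> T \<or> T \<subseteq> S"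
    and "y \<in> generate G (\<Union>\<C>)"
  shows "\<exists>S\<in>\<C>. y \<in> generate G S"
  using assms(3)
proof (induction rule: generate.induct)
  case one
  then show ?case using assms(1) generate.one by blast
next
  case (incl h)
  then show ?case by (meson UnionE generate.incl)
next
  case (inv h)
  then show ?case by (meson UnionE generate.inv)
next
  case (eng h1 h2)
  then obtain S T where "S \<in> \<C>" "h1 \<in> generate G S" "T \<in> \<C>" "h2 \<in> generate G T" by blast
  then show ?case
    using assms(2)[of S T] mono_generate[of S T] mono_generate[of T S]
    by (meson generate.eng subsetD)
qed

section \<open>Sets of pairwise commuting elements\<close>

lemma centralizer_iff:
  assumes "S \<subseteq> carrier G" "g \<in> carrier G"
  shows "g \<in> centralizer G S \<longleftrightarrow> S \<subseteq> centralizer G {g}"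
  using assms by (auto simp: centralizer_def)

lemma centralizer_singleton_subgroup: "g \<in> carrier G \<Longrightarrow> subgroup (centralizer G {g}) G"
  by (rule centralizer_subgroup) simp

lemma generate_commuting:
  assumes "A \<subseteq> centralizer G A" "B \<subseteq> generate G A"
  shows "B \<subseteq> centralizer G B"
proof -
  have A: "A \<subseteq> carrier G" using assms(1) centralizer_subset by blast
  have "A \<subseteq> centralizer G (generate G A)" using assms(1) centralizer_generate[OF A] by simp
  then have "generate G A \<subseteq> centralizer G (generate G A)"
    by (rule generate_subgroup_incl) (rule centralizer_subgroup[OF generate_incl[OF A]])
  then show ?thesis using assms(2) centralizer_antimono[OF assms(2)] by blast
qed

lemma insert_commuting:
  assumes "A \<subseteq> centralizer G A" "a \<in> centralizer G A"
  shows "insert a A \<subseteq> centralizer G (insert a A)"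
  using assms by (auto simp: centralizer_def)

lemma commuting_Union_chain:
  assumes "\<And>n::nat. A n \<subseteq> centralizer G (A n)" "\<And>n. A n \<subseteq> A (Suc n)"
  shows "(\<Union>n. A n) \<subseteq> centralizer G (\<Union>n. A n)"
proof
  fix a assume "a \<in> (\<Union>n. A n)"
  then obtain m where m: "a \<in> A m" by blast
  have "a \<otimes> b = b \<otimes> a" if "b \<in> A n" for b n
  proof -
    have "A m \<subseteq> A (max m n)" "A n \<subseteq> A (max m n)"
      using lift_Suc_mono_le[of A, OF assms(2)] by simp_all
    then show ?thesis using assms(1)[of "max m n"] m that centralizerD by blast
  qed
  moreover have "a \<in> carrier G" using m assms(1) centralizer_subset by blast
  ultimately show "a \<in> centralizer G (\<Union>n. A n)" by (auto simp: centralizer_def)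
qed

text \<open>For the commutator form, this says that the span of \<open>D\<close> and its orthogonal
  complement together give the whole group: \<open>h\<close> is the correction that removes the
  component of \<open>y\<close> along \<open>D\<close>.\<close>

definition commuting_complement :: "'a set \<Rightarrow> bool" where
  "commuting_complement D \<longleftrightarrow> (\<forall>y\<in>carrier G. \<exists>h\<in>generate G D. y \<otimes> h \<in> centralizer G D)"

end

section \<open>Groups with commutators in a centre of prime order\<close>

text \<open>The commutator of \<open>x\<close> and \<open>y\<close> appears as the central factor
  \<open>z\<close>. Commutation thus behaves like a bilinear form with values in a group of prime
  order.\<close>

locale central_prime_commutators = group G for G (structure) +
  fixes p :: nat
  assumes prime_p: "Factorial_Ring.prime p"
    and card_center: "card (group_center G) = p"
    and ex_commutator: "\<lbrakk>x \<in> carrier G; y \<in> carrier G\<rbrakk> \<Longrightarrow> \<exists>z\<in>group_center G. x \<otimes> y = z \<otimes> (y \<otimes> x)"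
begin

section \<open>The centre as a cyclic group of order \<open>p\<close>\<close>

abbreviation "Z \<equiv> group_center G"

lemma center_subgroup: "subgroup Z G"
  unfolding group_center_def by (rule centralizer_subgroup) simp

lemma center_carrier: "z \<in> Z \<Longrightarrow> z \<in> carrier G"
  by (simp add: group_center_def centralizer_def)

lemma center_commute: "z \<in> Z \<Longrightarrow> x \<in> carrier G \<Longrightarrow> z \<otimes> x = x \<otimes> z"
  by (simp add: group_center_def centralizer_def)

lemma p_gt_1: "p > 1"
  using prime_p prime_gt_1_nat by blast

lemma finite_center: "finite Z"
  using card_center p_gt_1 by (metis card.infinite not_less_zero)

lemma center_pow_p:
  assumes "z \<in> Z" shows "z [^] p = \<one>"
proof -
  interpret H: group "G\<lparr>carrier := Z\<rparr>"
    using center_subgroup subgroup_imp_group by blast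
  have "z [^]\<^bsub>G\<lparr>carrier := Z\<rparr>\<^esub> order (G\<lparr>carrier := Z\<rparr>) = \<one>"
    using H.pow_order_eq_1[of z] assms by simp
  then show ?thesis using card_center by (simp add: order_def nat_pow_consistent[symmetric])
qed

text \<open>The order of \<open>w\<close> divides the prime \<open>p\<close> and is not 1, so
  \<open>w\<close> generates \<open>Z\<close>.\<close>

lemma center_generator:
  assumes w: "w \<in> Z" "w \<noteq> \<one>" and z: "z \<in> Z"
  shows "\<exists>k::nat. w [^] k = z"
proof -
  have wc: "w \<in> carrier G" using w center_carrier by blast
  have "ord w dvd p" using pow_eq_id[OF wc] center_pow_p[OF w(1)] by blast
  moreover have "ord w \<noteq> 1" using ord_eq_1[OF wc] w(2) by blast
  ultimately have o: "ord w = p" using prime_p by (metis prime_nat_iff)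
  have "generate G {w} \<subseteq> Z"
    using generate_subgroup_incl center_subgroup w(1) by simp
  moreover have "card (generate G {w}) = card Z"
    using generate_pow_card[OF wc] o card_center by simp
  ultimately have "generate G {w} = Z"
    using finite_center card_subset_eq by blast
  moreover have "generate G {w} = {w [^] k | k. k \<in> (UNIV :: nat set)}"
    using o p_gt_1 by (intro generate_pow_nat[OF wc]) simp
  ultimately have "z \<in> {w [^] k | k. k \<in> (UNIV :: nat set)}" using z by simp
  then show ?thesis by auto
qed

text \<open>Each of the \<open>j\<close> factors \<open>b\<close> contributes one central
  \<open>w\<close> as it moves past \<open>a\<close>: linearity of the commutator form in one
  argument.\<close>

lemma pow_commutator:
  assumes "b \<in> carrier G" "a \<in> carrier G" "w \<in> Z" "b \<otimes> a = w \<otimes> (a \<otimes> b)"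
  shows "b [^] (j::nat) \<otimes> a = w [^] j \<otimes> (a \<otimes> b [^] j)"
proof (induction j)
  case 0
  then show ?case using assms by simp
next
  case (Suc j)
  have wc: "w \<in> carrier G" using assms center_carrier by blast
  have "b [^] Suc j \<otimes> a = b [^] j \<otimes> (b \<otimes> a)"
    using assms by (simp add: m_assoc)
  also have "\<dots> = b [^] j \<otimes> (w \<otimes> (a \<otimes> b))" using assms by simp
  also have "\<dots> = (b [^] j \<otimes> w) \<otimes> (a \<otimes> b)"
    using assms(1,2) wc by (simp add: m_assoc)
  also have "\<dots> = (w \<otimes> b [^] j) \<otimes> (a \<otimes> b)"
    using center_commute[OF assms(3), of "b [^] j"] assms(1) by simp
  also have "\<dots> = w \<otimes> ((b [^] j \<otimes> a) \<otimes> b)"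
    using assms(1,2) wc by (simp add: m_assoc)
  also have "\<dots> = w \<otimes> ((w [^] j \<otimes> (a \<otimes> b [^] j)) \<otimes> b)" using Suc by simp
  also have "\<dots> = (w \<otimes> w [^] j) \<otimes> (a \<otimes> (b [^] j \<otimes> b))"
    using assms(1,2) wc by (simp add: m_assoc)
  also have "w \<otimes> w [^] j = w [^] Suc j"
    using wc by (simp add: nat_pow_comm[of w 1, simplified])
  finally show ?case by simp
qed

text \<open>By linearity the commutator of \<open>a [^] p\<close> with \<open>y\<close> is the
  \<open>p\<close>-th power of a central element, hence trivial.\<close>

lemma pow_p_center:
  assumes "a \<in> carrier G" shows "a [^] p \<in> Z"
  unfolding group_center_def centralizer_def
proof (intro CollectI conjI ballI)
  show "a [^] p \<in> carrier G" using assms by simp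
  fix y assume y: "y \<in> carrier G"
  obtain z where z: "z \<in> Z" "a \<otimes> y = z \<otimes> (y \<otimes> a)" using ex_commutator assms y by blast
  show "a [^] p \<otimes> y = y \<otimes> a [^] p"
    using pow_commutator[OF assms y z] center_pow_p[OF z(1)] assms y by simp
qed

text \<open>The commutator \<open>w\<close> of \<open>b\<close> with \<open>a\<close> generates
  \<open>Z\<close>, so a suitable power of \<open>b\<close> cancels the commutator of
  \<open>y\<close> with \<open>a\<close>. This is the elementary projection step of the Gram-Schmidt
  process.\<close>

lemma ex_pow_commute:
  assumes "a \<in> carrier G" "b \<in> carrier G" "y \<in> carrier G" "b \<otimes> a \<noteq> a \<otimes> b"
  shows "\<exists>j::nat. (y \<otimes> b [^] j) \<otimes> a = a \<otimes> (y \<otimes> b [^] j)"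
proof -
  obtain z where z: "z \<in> Z" "y \<otimes> a = z \<otimes> (a \<otimes> y)" using ex_commutator assms by blast
  obtain w where w: "w \<in> Z" "b \<otimes> a = w \<otimes> (a \<otimes> b)" using ex_commutator assms by blast
  have zc: "z \<in> carrier G" using z center_carrier by blast
  have "w \<noteq> \<one>" using w assms by auto
  moreover have "inv z \<in> Z" by (rule subgroup.m_inv_closed[OF center_subgroup z(1)])
  ultimately obtain j :: nat where j: "w [^] j = inv z" using center_generator[OF w(1)] by blast
  have "(y \<otimes> b [^] j) \<otimes> a = y \<otimes> (b [^] j \<otimes> a)" using assms by (simp add: m_assoc)
  also have "\<dots> = y \<otimes> (inv z \<otimes> (a \<otimes> b [^] j))"
    using pow_commutator[OF assms(2,1) w] j by simp
  also have "\<dots> = (y \<otimes> inv z) \<otimes> (a \<otimes> b [^] j)"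
    using assms zc by (simp add: m_assoc)
  also have "\<dots> = (inv z \<otimes> y) \<otimes> (a \<otimes> b [^] j)"
    using center_commute[OF \<open>inv z \<in> Z\<close> assms(3)] by simp
  also have "\<dots> = inv z \<otimes> ((y \<otimes> a) \<otimes> b [^] j)"
    using assms zc by (simp add: m_assoc)
  also have "\<dots> = inv z \<otimes> ((z \<otimes> (a \<otimes> y)) \<otimes> b [^] j)" using z by simp
  also have "\<dots> = inv z \<otimes> (z \<otimes> (a \<otimes> (y \<otimes> b [^] j)))"
    using assms zc by (simp add: m_assoc)
  also have "\<dots> = a \<otimes> (y \<otimes> b [^] j)"
    using assms zc by (simp add: m_assoc[symmetric])
  finally show ?thesis by blast
qed

text \<open>Conjugating \<open>x\<close> only multiplies it by elements of the finite group
  \<open>Z\<close>, so \<open>x\<close> has finitely many conjugates.\<close>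

lemma index_centralizer_singleton:
  assumes "x \<in> carrier G" shows "index_le_omega1 G (centralizer G {x})"
proof -
  let ?f = "\<lambda>g. inv g \<otimes> x \<otimes> g"
  have "|rcosets (centralizer G {x})| \<le>o |?f ` carrier G|"
    using assms conj_eq_iff
    by (intro card_of_rcosets_le centralizer_subgroup) (auto simp: centralizer_def)
  moreover have "?f ` carrier G \<subseteq> (\<lambda>z. z \<otimes> x) ` Z"
  proof safe
    fix g assume g: "g \<in> carrier G"
    obtain z where z: "z \<in> Z" "x \<otimes> g = z \<otimes> (g \<otimes> x)" using ex_commutator assms g by blast
    have zc: "z \<in> carrier G" using z center_carrier by blast
    have "inv g \<otimes> x \<otimes> g = inv g \<otimes> (z \<otimes> (g \<otimes> x))" using z g assms by (simp add: m_assoc)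
    also have "\<dots> = (inv g \<otimes> z) \<otimes> (g \<otimes> x)" using g zc assms by (simp add: m_assoc)
    also have "\<dots> = (z \<otimes> inv g) \<otimes> (g \<otimes> x)" using center_commute[OF z(1), of "inv g"] g by simp
    also have "\<dots> = z \<otimes> (inv g \<otimes> (g \<otimes> x))" using g zc assms by (simp add: m_assoc)
    also have "\<dots> = z \<otimes> x" using g assms by (simp add: m_assoc[symmetric])
    finally show "?f g \<in> (\<lambda>z. z \<otimes> x) ` Z" using z by blast
  qed
  ultimately show ?thesis
    using finite_center countable_ordLeq_omega1 countable_finite finite_imageI finite_subset ordLeq_transitive
    by meson
qed

text \<open>The commutator of \<open>g\<close> with an element of \<open>W\<close> lies in
  \<open>W\<close>, because \<open>g\<close> normalizes \<open>W\<close>, and also in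
  \<open>Z\<close>, so it is trivial.\<close>

lemma normalizer_le_centralizer:
  assumes W: "subgroup W G" "W \<inter> Z \<subseteq> {\<one>}"
  shows "normalizer G W \<subseteq> centralizer G W"
proof
  fix g assume g: "g \<in> normalizer G W"
  have Wc: "W \<subseteq> carrier G" using W subgroup.subset by blast
  have "g \<in> carrier G"
    using g by (simp add: normalizer_def stabilizer_def)
  moreover have "g \<otimes> w = w \<otimes> g" if w: "w \<in> W" for w
  proof -
    have gc: "g \<in> carrier G" "g \<otimes> w \<otimes> inv g \<in> W"
      using normalizer_conj_closed[OF g Wc w] by auto
    have wc: "w \<in> carrier G" using w Wc by blast
    obtain z where z: "z \<in> Z" "g \<otimes> w = z \<otimes> (w \<otimes> g)" using ex_commutator gc wc by blast
    have zc: "z \<in> carrier G" using z center_carrier by blast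
    have "g \<otimes> w \<otimes> inv g \<otimes> inv w \<in> W"
      using gc w W subgroup.m_closed subgroup.m_inv_closed by metis
    moreover have "g \<otimes> w \<otimes> inv g \<otimes> inv w = z"
      unfolding z(2) using gc wc zc by (simp add: m_assoc)
    ultimately have "z = \<one>" using z W by blast
    then show ?thesis using z gc wc by simp
  qed
  ultimately show "g \<in> centralizer G W" by (simp add: centralizer_def)
qed

text \<open>Here class \<open>Y\<close> enters: it bounds the index of the normalizer, and the
  normalizer lies inside the centralizer.\<close>

lemma index_centralizer_disjoint:
  assumes Y: "class_Y \<omega>\<^sub>2 G" and S: "S \<subseteq> carrier G" "countable S" "generate G S \<inter> Z \<subseteq> {\<one>}"
  shows "index_le_omega1 G (centralizer G S)"
proof -
  have gen: "generated_by_fewer G \<omega>\<^sub>2 (generate G S)"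
    unfolding generated_by_fewer_def ordLess_omega2_iff
    using S(1) countable_ordLeq_omega1[OF S(2)] by blast
  have W: "subgroup (generate G S) G" by (rule generate_is_subgroup[OF S(1)])
  have "index_le_omega1 G (normalizer G (generate G S))"
    using Y gen unfolding class_Y_def ordLess_omega2_iff by blast
  then show ?thesis
    unfolding centralizer_generate[OF S(1), symmetric]
    by (rule index_le_omega1_mono[OF _ normalizer_le_centralizer[OF W S(3)]
          normalizer_imp_subgroup[OF generate_incl[OF S(1)]]
          centralizer_subgroup[OF generate_incl[OF S(1)]]])
qed

text \<open>Take a maximal \<open>S\<close> in \<open>A\<close> generating a subgroup that meets
  \<open>Z\<close> trivially. Modulo \<open>Z\<close>, each element of \<open>A\<close> then depends
  on \<open>S\<close>, so whatever centralizes \<open>S\<close> centralizes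
  \<open>A\<close>.\<close>

lemma index_centralizer_elementary_abelian:
  assumes Y: "class_Y \<omega>\<^sub>2 G" and A: "A \<subseteq> centralizer G A" "countable A"
    and exponent: "\<And>a. a \<in> A \<Longrightarrow> a [^] p = \<one>"
  shows "index_le_omega1 G (centralizer G A)"
proof -
  have Ac: "A \<subseteq> carrier G" using A centralizer_subset by blast
  let ?P = "{S. S \<subseteq> A \<and> generate G S \<inter> Z \<subseteq> {\<one>}}"
  have "\<exists>M\<in>?P. \<forall>S\<in>?P. M \<subseteq> S \<longrightarrow> S = M"
  proof (rule subset_Zorn_nonempty)
    show "?P \<noteq> {}" using generate_empty by auto
    fix \<C> assume ne: "\<C> \<noteq> {}" and ch: "subset.chain ?P \<C>"
    then have "\<C> \<subseteq> ?P" "\<And>S T. S \<in> \<C> \<Longrightarrow> T \<in> \<C> \<Longrightarrow> S \<subseteq> T \<or> T \<subseteq> S"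
      by (auto simp: subset_chain_def)
    then show "\<Union>\<C> \<in> ?P" using generate_Union_chain[OF ne] by blast
  qed
  then obtain S where S: "S \<subseteq> A" "generate G S \<inter> Z \<subseteq> {\<one>}"
    and max: "\<And>S'. S' \<in> ?P \<Longrightarrow> S \<subseteq> S' \<Longrightarrow> S' = S" by auto
  have Sc: "S \<subseteq> carrier G" using S Ac by blast
  have "centralizer G S \<subseteq> centralizer G A"
  proof
    fix g assume g: "g \<in> centralizer G S"
    have gc: "g \<in> carrier G" using g by (simp add: centralizer_def)
    have "g \<otimes> a = a \<otimes> g" if a: "a \<in> A" for a
    proof (cases "a \<in> S")
      case True
      then show ?thesis using g centralizerD by blast
    next
      case False
      have ac: "a \<in> carrier G" and aS: "a \<in> centralizer G S"
        using a Ac A(1) S(1) centralizer_antimono by blast+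
      \<comment> \<open>Maximality of \<open>S\<close> produces a nontrivial central element
        \<open>z\<close>, which has the form \<open>w \<otimes> a [^] i\<close> with
        \<open>w\<close> generated by \<open>S\<close>.\<close>
      have "insert a S \<notin> ?P" using max[of "insert a S"] False by blast
      then obtain z where z: "z \<in> generate G (insert a S)" "z \<in> Z" "z \<noteq> \<one>"
        using a S(1) by blast
      then obtain w and i :: nat where w: "w \<in> generate G S" "z = w \<otimes> a [^] i"
        using generate_insert_commuting[OF Sc aS exponent[OF a] _ z(1)] p_gt_1
        by (metis gr_implies_not0 neq0_conv)
      have wc: "w \<in> carrier G" using w Sc generate_in_carrier by blast
      \<comment> \<open>Otherwise \<open>a [^] i\<close> is trivial and \<open>z\<close> would be a
        nontrivial central element already generated by \<open>S\<close>.\<close>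
      have "\<not> p dvd i"
      proof
        assume "p dvd i"
        then have "a [^] i = \<one>"
          using exponent[OF a] ac by (auto simp: nat_pow_pow[symmetric])
        then have "z \<in> generate G S" using w wc by simp
        then show False using z S by blast
      qed
      then have "coprime i p"
        using prime_p by (metis coprime_commute prime_imp_coprime)
      moreover have "i \<noteq> 0" using \<open>\<not> p dvd i\<close> by (metis dvd_0_right)
      \<comment> \<open>As \<open>a\<close> has exponent \<open>p\<close>, inverting
        \<open>i\<close> modulo \<open>p\<close> recovers \<open>a\<close> from
        \<open>a [^] i\<close>, which commutes with \<open>g\<close> because \<open>w\<close> and
        \<open>z\<close> do.\<close>
      ultimately obtain j k where j: "i * j = p * k + 1"
        using bezout_nat[of i p] by auto
      have "g \<otimes> a [^] i = a [^] i \<otimes> g"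
      proof -
        have e: "a [^] i = inv w \<otimes> z" using w wc ac by (simp add: m_assoc[symmetric])
        have "inv w \<in> centralizer G {g}"
        proof (rule subgroup.m_inv_closed[OF centralizer_subgroup])
          show "w \<in> centralizer G {g}"
            using commute_generate[OF Sc g w(1)] wc by (simp add: centralizer_def)
        qed (use gc in simp)
        moreover have "z \<in> centralizer G {g}"
          using center_commute[OF z(2) gc] center_carrier[OF z(2)] by (simp add: centralizer_def)
        ultimately have "a [^] i \<in> centralizer G {g}"
          unfolding e using subgroup.m_closed[OF centralizer_subgroup[of "{g}"]] gc by simp
        then show ?thesis by (simp add: centralizer_def)
      qed
      then have "(a [^] i) [^] j \<otimes> g = g \<otimes> (a [^] i) [^] j"
        using gc ac group_commutes_pow[of "a [^] i" g j] by simp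
      moreover have "(a [^] i) [^] j = a"
      proof -
        have "a [^] (i * j) = (a [^] p) [^] k \<otimes> a"
          unfolding j using ac by (metis nat_pow_closed nat_pow_eone nat_pow_mult nat_pow_pow)
        then show ?thesis using ac exponent[OF a] by (simp add: nat_pow_pow)
      qed
      ultimately show ?thesis by simp
    qed
    then show "g \<in> centralizer G A" using gc by (simp add: centralizer_def)
  qed
  with index_centralizer_disjoint[OF Y Sc countable_subset[OF S(1) A(2)] S(2)]
  show ?thesis
    by (rule index_le_omega1_mono[OF _ _ centralizer_subgroup[OF Sc] centralizer_subgroup[OF Ac]])
qed

text \<open>Reduction to exponent \<open>p\<close>: if some \<open>x\<close> in \<open>A\<close> has
  a nontrivial \<open>p\<close>-th power, powers of \<open>x\<close> correct all of \<open>A\<close>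
  to exponent \<open>p\<close>. The elements of \<open>A\<close> are recovered from the corrected
  ones and \<open>x\<close>, and centralizing the single element \<open>x\<close> costs only a
  finite index.\<close>

lemma index_centralizer_commuting:
  assumes Y: "class_Y \<omega>\<^sub>2 G" and A: "A \<subseteq> centralizer G A" "countable A"
  shows "index_le_omega1 G (centralizer G A)"
proof (cases "\<forall>a\<in>A. a [^] p = \<one>")
  case True
  then show ?thesis using index_centralizer_elementary_abelian[OF Y A] by blast
next
  case False
  have Ac: "A \<subseteq> carrier G" using A centralizer_subset by blast
  from False obtain x where x: "x \<in> A" "x [^] p \<noteq> \<one>" by blast
  then have xc: "x \<in> carrier G" using Ac by blast
  have "\<exists>k::nat. (x [^] p) [^] k = a [^] p" if "a \<in> A" for a
    using center_generator[OF pow_p_center[OF xc] x(2) pow_p_center] that Ac by blast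
  then obtain k :: "'a \<Rightarrow> nat" where k: "\<And>a. a \<in> A \<Longrightarrow> (x [^] p) [^] k a = a [^] p"
    by metis
  \<comment> \<open>Both \<open>p\<close>-th powers are central, so multiplying by a power of \<open>x\<close> makes the \<open>p\<close>-th power trivial.\<close>
  define t where "t a = a \<otimes> inv (x [^] k a)" for a
  have genA: "subgroup (generate G A) G" by (rule generate_is_subgroup[OF Ac])
  have t_gen: "t ` A \<subseteq> generate G A"
  proof safe
    fix a assume a: "a \<in> A"
    have "x [^] k a \<in> generate G A"
      using subgroup_int_pow_closed[OF genA generate.incl[OF x(1)], of "int (k a)"] by (simp add: int_pow_int)
    then show "t a \<in> generate G A"
      unfolding t_def by (intro generate.eng generate.incl[OF a] generate_m_inv_closed[OF Ac])
  qed
  have tc: "t ` A \<subseteq> centralizer G (t ` A)"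
    by (rule generate_commuting[OF A(1) t_gen])
  have t_carrier: "t ` A \<subseteq> carrier G" using tc centralizer_subset by blast
  have t_pow: "b [^] p = \<one>" if b: "b \<in> t ` A" for b
  proof -
    obtain a where a: "a \<in> A" "b = t a" using b by blast
    have ac: "a \<in> carrier G" using a Ac by blast
    have "x [^] k a \<otimes> a = a \<otimes> x [^] k a"
      using A(1) a(1) x(1) xc ac by (intro group_commutes_pow) (auto simp: centralizer_def)
    then have "x [^] k a \<in> centralizer G {a}" using xc by (simp add: centralizer_def)
    then have "inv (x [^] k a) \<in> centralizer G {a}"
      by (rule subgroup.m_inv_closed[OF centralizer_singleton_subgroup[OF ac]])
    then have "a \<otimes> inv (x [^] k a) = inv (x [^] k a) \<otimes> a" by (simp add: centralizer_def)
    then have "b [^] p = a [^] p \<otimes> inv (x [^] k a) [^] p"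
      unfolding a t_def by (rule pow_mult_distrib) (use ac xc in auto)
    also have "inv (x [^] k a) [^] p = inv ((x [^] p) [^] k a)"
      using xc by (simp add: nat_pow_inv nat_pow_pow mult.commute)
    finally show ?thesis using k[OF a(1)] ac by simp
  qed
  \<comment> \<open>Each \<open>a\<close> in \<open>A\<close> is the product of \<open>t a\<close>
    and a power of \<open>x\<close>.\<close>
  have "centralizer G (t ` A) \<inter> centralizer G {x} \<subseteq> centralizer G A"
  proof
    fix g assume g: "g \<in> centralizer G (t ` A) \<inter> centralizer G {x}"
    have gc: "g \<in> carrier G" using g by (simp add: centralizer_def)
    have sg: "subgroup (centralizer G {g}) G" by (rule centralizer_singleton_subgroup[OF gc])
    have "a \<in> centralizer G {g}" if a: "a \<in> A" for a
    proof -
      have ac: "a \<in> carrier G" using a Ac by blast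
      have "t a \<in> centralizer G {g}" using g centralizer_iff[OF t_carrier gc] a by auto
      moreover have "x [^] k a \<in> centralizer G {g}"
        using group_commutes_pow[of x g "k a"] g gc xc by (auto simp: centralizer_def)
      ultimately have "t a \<otimes> x [^] k a \<in> centralizer G {g}"
        by (rule subgroup.m_closed[OF sg])
      then show ?thesis using ac xc by (simp add: t_def m_assoc)
    qed
    then show "g \<in> centralizer G A" using centralizer_iff[OF Ac gc] by blast
  qed
  moreover have "index_le_omega1 G (centralizer G (t ` A) \<inter> centralizer G {x})"
    by (rule index_le_omega1_Int[OF
          index_centralizer_elementary_abelian[OF Y tc countable_image[OF A(2)] t_pow]
          index_centralizer_singleton[OF xc]
          centralizer_subgroup[OF t_carrier] centralizer_singleton_subgroup[OF xc]])
  ultimately show ?thesis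
    using index_le_omega1_mono[OF _ _ subgroups_Inter_pair[OF
          centralizer_subgroup[OF t_carrier] centralizer_singleton_subgroup[OF xc]]
        centralizer_subgroup[OF Ac]] by blast
qed

text \<open>Correct \<open>y\<close> first by \<open>h\<close> against \<open>D\<close>, then by a
  power of \<open>b\<close> against \<open>a\<close>, then by a power of \<open>a\<close> against
  \<open>b\<close>. No step spoils an earlier one, since \<open>a\<close> and \<open>b\<close>
  centralize \<open>D\<close> and \<open>a\<close> commutes with its own powers.\<close>

lemma commuting_complement_insert_pair:
  assumes D: "D \<subseteq> carrier G" "commuting_complement D"
    and ab: "a \<in> centralizer G D" "b \<in> centralizer G D" "a \<otimes> b \<noteq> b \<otimes> a"
  shows "commuting_complement (insert a (insert b D))"
  unfolding commuting_complement_def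
proof
  fix y assume y: "y \<in> carrier G"
  let ?D = "insert a (insert b D)"
  have ac: "a \<in> carrier G" and bc: "b \<in> carrier G" using ab by (auto simp: centralizer_def)
  have Dc: "?D \<subseteq> carrier G" using D ac bc by blast
  have gen: "subgroup (generate G ?D) G" by (rule generate_is_subgroup[OF Dc])
  have pw: "z [^] n \<in> H" if "subgroup H G" "z \<in> H" for H z and n :: nat
    using subgroup_int_pow_closed[OF that, of "int n"] by (simp add: int_pow_int)
  have sD: "subgroup (centralizer G D) G" by (rule centralizer_subgroup[OF D(1)])
  obtain h where h: "h \<in> generate G D" "y \<otimes> h \<in> centralizer G D"
    using D(2) y unfolding commuting_complement_def by blast
  have hc: "h \<in> carrier G" using h D generate_in_carrier by blast
  obtain j :: nat where j: "(y \<otimes> h \<otimes> b [^] j) \<otimes> a = a \<otimes> (y \<otimes> h \<otimes> b [^] j)"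
    using ex_pow_commute[OF ac bc, of "y \<otimes> h"] ab(3) y hc by fastforce
  obtain i :: nat where i: "(y \<otimes> h \<otimes> b [^] j \<otimes> a [^] i) \<otimes> b = b \<otimes> (y \<otimes> h \<otimes> b [^] j \<otimes> a [^] i)"
    using ex_pow_commute[OF bc ac, of "y \<otimes> h \<otimes> b [^] j"] ab(3) y hc bc by fastforce
  have "y \<otimes> h \<otimes> b [^] j \<in> centralizer G {a}"
    using j y hc bc by (simp add: centralizer_def)
  moreover have "a [^] i \<in> centralizer G {a}"
    by (rule pw[OF centralizer_singleton_subgroup[OF ac]]) (use ac in \<open>simp add: centralizer_def\<close>)
  ultimately have 1: "y \<otimes> h \<otimes> b [^] j \<otimes> a [^] i \<in> centralizer G {a}"
    by (rule subgroup.m_closed[OF centralizer_singleton_subgroup[OF ac]])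
  have 2: "y \<otimes> h \<otimes> b [^] j \<otimes> a [^] i \<in> centralizer G D"
    by (intro subgroup.m_closed[OF sD] h pw[OF sD] ab)
  have "y \<otimes> h \<otimes> b [^] j \<otimes> a [^] i \<in> centralizer G ?D"
    using 1 2 i by (auto simp: centralizer_def)
  moreover have "y \<otimes> h \<otimes> b [^] j \<otimes> a [^] i = y \<otimes> (h \<otimes> b [^] j \<otimes> a [^] i)"
    using y hc ac bc by (simp add: m_assoc)
  moreover have "h \<otimes> b [^] j \<otimes> a [^] i \<in> generate G ?D"
    using h(1) mono_generate[of D ?D] generate.incl[of a ?D] generate.incl[of b ?D]
    by (intro generate.eng pw[OF gen]) auto
  ultimately show "\<exists>h\<in>generate G ?D. y \<otimes> h \<in> centralizer G ?D" by metis
qed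

text \<open>
  The two sets collect the two halves of the hyperbolic pairs found so far. The last conjunct
  lets the next element be corrected by a product of these, so as to commute with all of them.
\<close>

definition symplectic_state :: "'a set \<Rightarrow> 'a set \<Rightarrow> bool" where
  "symplectic_state A B \<longleftrightarrow> A \<subseteq> centralizer G A \<and> B \<subseteq> centralizer G B \<and>
     countable A \<and> countable B \<and> commuting_complement (A \<union> B)"

text \<open>One Gram-Schmidt step: \<open>u\<close> is corrected to \<open>u \<otimes> h\<close>,
  which commutes with all previous pairs. If this is central, nothing new is required; otherwise it
  becomes one half of a new hyperbolic pair.\<close>

lemma symplectic_step:
  assumes AB: "symplectic_state A B" and u: "u \<in> carrier G"
  shows "\<exists>A' B'. symplectic_state A' B' \<and> A \<subseteq> A' \<and> B \<subseteq> B' \<and>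
    centralizer G (A' \<union> B') \<subseteq> centralizer G {u}"
proof -
  let ?D = "A \<union> B"
  have D: "?D \<subseteq> carrier G" "commuting_complement ?D"
    using AB centralizer_subset unfolding symplectic_state_def by blast+
  have sD: "subgroup (centralizer G ?D) G" by (rule centralizer_subgroup[OF D(1)])
  obtain h where h: "h \<in> generate G ?D" "u \<otimes> h \<in> centralizer G ?D"
    using D(2) u unfolding commuting_complement_def by blast
  have hc: "h \<in> carrier G" using h D generate_in_carrier by blast
  \<comment> \<open>As \<open>h\<close> is generated by \<open>?D\<close>, anything centralizing
    \<open>?D\<close> commutes with \<open>h\<close>, and so commutes with \<open>u\<close> once it
    commutes with \<open>u \<otimes> h\<close>.\<close>
  have u_cent: "g \<in> centralizer G {u}"
    if g: "g \<in> centralizer G ?D" "u \<otimes> h \<in> centralizer G {g}" for g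
  proof -
    have gc: "g \<in> carrier G" using g by (simp add: centralizer_def)
    note sg = centralizer_singleton_subgroup[OF gc]
    have "h \<in> centralizer G {g}"
      using commute_generate[OF D(1) g(1) h(1)] hc by (simp add: centralizer_def)
    then have "u \<otimes> h \<otimes> inv h \<in> centralizer G {g}"
      by (intro subgroup.m_closed[OF sg] subgroup.m_inv_closed[OF sg] g)
    then show ?thesis using u hc gc by (simp add: m_assoc centralizer_def)
  qed
  show ?thesis
  proof (cases "u \<otimes> h \<in> Z")
    case True
    have "centralizer G ?D \<subseteq> centralizer G {u}"
    proof
      fix g assume g: "g \<in> centralizer G ?D"
      then have "u \<otimes> h \<in> centralizer G {g}"
        using True by (simp add: centralizer_def group_center_def)
      then show "g \<in> centralizer G {u}" by (rule u_cent[OF g])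
    qed
    then show ?thesis using AB by blast
  next
    case False
    let ?a = "u \<otimes> h"
    have ac: "?a \<in> carrier G" using u hc by simp
    then obtain g where g: "g \<in> carrier G" "?a \<otimes> g \<noteq> g \<otimes> ?a"
      using False by (auto simp: group_center_def centralizer_def)
    obtain k where k: "k \<in> generate G ?D" "g \<otimes> k \<in> centralizer G ?D"
      using D(2) g unfolding commuting_complement_def by blast
    have kc: "k \<in> carrier G" using k D generate_in_carrier by blast
    let ?b = "g \<otimes> k"
    note sa = centralizer_singleton_subgroup[OF ac]
    \<comment> \<open>The correction \<open>k\<close> commutes with \<open>?a\<close>, so passing
      from \<open>g\<close> to \<open>?b\<close> keeps the commutator with \<open>?a\<close>
      nontrivial.\<close>
    have ab: "?a \<otimes> ?b \<noteq> ?b \<otimes> ?a"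
    proof
      assume "?a \<otimes> ?b = ?b \<otimes> ?a"
      then have "?b \<in> centralizer G {?a}" using g kc by (simp add: centralizer_def)
      moreover have "k \<in> centralizer G {?a}"
        using commute_generate[OF D(1) h(2) k(1)] kc by (simp add: centralizer_def)
      ultimately have "?b \<otimes> inv k \<in> centralizer G {?a}"
        by (rule subgroup.m_closed[OF sa _ subgroup.m_inv_closed[OF sa]])
      then have "g \<in> centralizer G {?a}" using g kc by (simp add: m_assoc)
      then show False using g by (simp add: centralizer_def)
    qed
    have "commuting_complement (insert ?a (insert ?b ?D))"
      by (rule commuting_complement_insert_pair[OF D h(2) k(2) ab])
    \<comment> \<open>The two non-commuting halves go to different sides, so each side remains
      commuting.\<close>
    moreover have "insert ?a A \<union> insert ?b B = insert ?a (insert ?b ?D)" by blast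
    moreover have "insert ?a A \<subseteq> centralizer G (insert ?a A)"
      using AB h(2) unfolding symplectic_state_def
      by (intro insert_commuting) (auto simp: centralizer_Un)
    moreover have "insert ?b B \<subseteq> centralizer G (insert ?b B)"
      using AB k(2) unfolding symplectic_state_def
      by (intro insert_commuting) (auto simp: centralizer_Un)
    ultimately have "symplectic_state (insert ?a A) (insert ?b B)"
      using AB by (simp add: symplectic_state_def)
    moreover have "centralizer G (insert ?a A \<union> insert ?b B) \<subseteq> centralizer G {u}"
    proof
      fix x assume x: "x \<in> centralizer G (insert ?a A \<union> insert ?b B)"
      then have "?a \<in> centralizer G {x}" "x \<in> centralizer G ?D"
        using ac by (auto simp: centralizer_def)
      then show "x \<in> centralizer G {u}" using u_cent by blast
    qed
    ultimately show ?thesis by blast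
  qed
qed

text \<open>Running the process along an enumeration of \<open>S\<close> gives two countable
  commuting sets, each with a centralizer of small index, and the intersection of these two
  centralizers centralizes \<open>S\<close>.\<close>

lemma index_centralizer_countable:
  assumes Y: "class_Y \<omega>\<^sub>2 G" and S: "S \<subseteq> carrier G" "countable S"
  shows "index_le_omega1 G (centralizer G S)"
proof (cases "S = {}")
  case True
  then show ?thesis
    using index_centralizer_commuting[OF Y, of S] by simp
next
  case False
  let ?u = "from_nat_into S"
  have u: "?u n \<in> carrier G" for n using from_nat_into[OF False] S(1) by blast
  \<comment> \<open>Stage \<open>Suc n\<close> deals with the \<open>n\<close>-th element of
    \<open>S\<close>; the process starts from two empty sets, for which the correction \<one> always
    works.\<close>
  have "\<exists>f. \<forall>n. case_prod symplectic_state (f n) \<and>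
    (fst (f n) \<subseteq> fst (f (Suc n)) \<and> snd (f n) \<subseteq> snd (f (Suc n)) \<and>
     centralizer G (fst (f (Suc n)) \<union> snd (f (Suc n))) \<subseteq> centralizer G {?u n})"
  proof (rule dependent_nat_choice)
    show "\<exists>s. case_prod symplectic_state s"
      using generate.one[of G "{}"]
      by (intro exI[of _ "({}, {})"]) (auto simp: symplectic_state_def commuting_complement_def centralizer_def)
    fix s n assume "case_prod symplectic_state s"
    then show "\<exists>t. case_prod symplectic_state t \<and> (fst s \<subseteq> fst t \<and> snd s \<subseteq> snd t \<and>
        centralizer G (fst t \<union> snd t) \<subseteq> centralizer G {?u n})"
      using symplectic_step[OF _ u[of n]] by (auto split: prod.splits)
  qed
  then obtain f where f: "\<And>n. symplectic_state (fst (f n)) (snd (f n))"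
    "\<And>n. fst (f n) \<subseteq> fst (f (Suc n))" "\<And>n. snd (f n) \<subseteq> snd (f (Suc n))"
    "\<And>n. centralizer G (fst (f (Suc n)) \<union> snd (f (Suc n))) \<subseteq> centralizer G {?u n}"
    unfolding case_prod_beta by blast
  let ?A = "\<Union>n. fst (f n)" and ?B = "\<Union>n. snd (f n)"
  have A: "?A \<subseteq> centralizer G ?A" "countable ?A" and B: "?B \<subseteq> centralizer G ?B" "countable ?B"
    using f unfolding symplectic_state_def by (intro commuting_Union_chain countable_UN; blast)+
  have sA: "subgroup (centralizer G ?A) G" and sB: "subgroup (centralizer G ?B) G"
    using A(1) B(1) centralizer_subset by (blast intro: centralizer_subgroup)+
  have "index_le_omega1 G (centralizer G ?A \<inter> centralizer G ?B)"
    by (rule index_le_omega1_Int[OF index_centralizer_commuting[OF Y A]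
          index_centralizer_commuting[OF Y B] sA sB])
  moreover have "centralizer G ?A \<inter> centralizer G ?B \<subseteq> centralizer G S"
  proof
    fix g assume g: "g \<in> centralizer G ?A \<inter> centralizer G ?B"
    have "g \<otimes> s = s \<otimes> g" if s: "s \<in> S" for s
    proof -
      obtain n where n: "s = ?u n"
        using from_nat_into_surj[OF S(2) s] by metis
      have "g \<in> centralizer G (fst (f (Suc n)) \<union> snd (f (Suc n)))"
        using g by (auto simp: centralizer_def)
      then have "g \<in> centralizer G {?u n}" using f(4) by blast
      then show ?thesis unfolding n by (simp add: centralizer_def)
    qed
    then show "g \<in> centralizer G S" using g by (auto simp: centralizer_def)
  qed
  ultimately show ?thesis
    using index_le_omega1_mono[OF _ _ subgroups_Inter_pair[OF sA sB] centralizer_subgroup[OF S(1)]]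
    by blast
qed

end

section \<open>Extraspecial groups and weak Kurepa trees\<close>

text \<open>The isomorphism with the integers modulo \<open>p\<close> counts the centre, and the
  derived subgroup being the centre makes commutators central.\<close>

lemma (in group) central_prime_commutators_of_extraspecial:
  assumes "extraspecial p G"
  shows "central_prime_commutators G p"
proof (unfold_locales)
  show p: "Factorial_Ring.prime p" using assms by (simp add: extraspecial_def)
  show "card (group_center G) = p"
  proof -
    have "G\<lparr>carrier := group_center G\<rparr> \<cong> integer_mod_group p"
      using assms by (simp add: extraspecial_def)
    then obtain h where "bij_betw h (group_center G) (carrier (integer_mod_group p))"
      by (auto simp: is_iso_def iso_def)
    then have "card (group_center G) = card (carrier (integer_mod_group p))"
      by (rule bij_betw_same_card)
    then show ?thesis using p by (auto simp: carrier_integer_mod_group)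
  qed
  fix x y assume xy: "x \<in> carrier G" "y \<in> carrier G"
  have "x \<otimes> y \<otimes> inv x \<otimes> inv y \<in> derived G (carrier G)"
    unfolding derived_def by (rule generate.incl) (use xy in blast)
  then have "x \<otimes> y \<otimes> inv x \<otimes> inv y \<in> group_center G"
    using assms by (simp add: extraspecial_def)
  moreover have "x \<otimes> y = (x \<otimes> y \<otimes> inv x \<otimes> inv y) \<otimes> (y \<otimes> x)"
  proof -
    have "(x \<otimes> y \<otimes> inv x \<otimes> inv y) \<otimes> (y \<otimes> x) = x \<otimes> y \<otimes> inv x \<otimes> (inv y \<otimes> y) \<otimes> x"
      using xy by (simp only: m_assoc m_closed inv_closed)
    also have "\<dots> = x \<otimes> y" using xy by (simp add: m_assoc)
    finally show ?thesis by simp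
  qed
  ultimately show "\<exists>z\<in>group_center G. x \<otimes> y = z \<otimes> (y \<otimes> x)" by blast
qed

theorem theorem5p4:
  fixes E :: "('a, 'b) monoid_scheme" and p :: nat
  assumes "extraspecial p E"
    and "|carrier E| =o \<omega>\<^sub>2"
    and "class_Y \<omega>\<^sub>2 E"
    and "\<not> class_Z \<omega>\<^sub>2 E"
  shows "\<exists>(T :: nat set set) (r :: nat set rel). weak_Kurepa_tree T r"
proof -
  interpret group E using assms(3) by (simp add: class_Y_def)
  interpret central_prime_commutators E p
    by (rule central_prime_commutators_of_extraspecial[OF assms(1)])
  \<comment> \<open>Failure of class \<open>Z\<close> gives a bad generated subgroup;
    \<open>centralizer_generate\<close> moves the failure to its generating set
    \<open>S\<close>.\<close>
  obtain S where S: "S \<subseteq> carrier E" "|S| \<le>o \<omega>\<^sub>1" "\<not> index_le_omega1 E (centralizer E S)"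
    using assms(4) is_group centralizer_generate
    unfolding class_Z_def generated_by_fewer_def ordLess_omega2_iff by metis
  \<comment> \<open>Nonemptiness is what permits an enumeration of \<open>S\<close>, possibly with
    repetitions, by the whole field of \<open>\<omega>\<^sub>1\<close>.\<close>
  then have "S \<noteq> {}"
    using index_centralizer_countable[OF assms(3), of "{}"] by (metis countable_empty empty_subsetI)
  moreover have "|S| \<le>o |Field \<omega>\<^sub>1|"
    using S(2) card_of_Field_ordIso[OF Card_order_omega1] ordIso_symmetric ordLeq_ordIso_trans by blast
  ultimately obtain s where s: "s ` Field \<omega>\<^sub>1 = S"
    using card_of_ordLeq2[of S "Field \<omega>\<^sub>1"] by blast
  define f where "f g = restrict (\<lambda>\<alpha>. inv\<^bsub>E\<^esub> g \<otimes>\<^bsub>E\<^esub> s \<alpha> \<otimes>\<^bsub>E\<^esub> g) (Field \<omega>\<^sub>1)" for g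
  have f_eq: "restrict (f g) A = restrict (f h) A \<longleftrightarrow> g \<otimes>\<^bsub>E\<^esub> inv\<^bsub>E\<^esub> h \<in> centralizer E (s ` A)"
    if gh: "g \<in> carrier E" "h \<in> carrier E" and A: "A \<subseteq> Field \<omega>\<^sub>1" for g h A
  proof -
    have "restrict (f g) A = restrict (f h) A \<longleftrightarrow>
      (\<forall>\<alpha>\<in>A. inv\<^bsub>E\<^esub> g \<otimes>\<^bsub>E\<^esub> s \<alpha> \<otimes>\<^bsub>E\<^esub> g = inv\<^bsub>E\<^esub> h \<otimes>\<^bsub>E\<^esub> s \<alpha> \<otimes>\<^bsub>E\<^esub> h)"
      using A by (auto simp: f_def fun_eq_iff restrict_def subset_iff)
    also have "\<dots> \<longleftrightarrow> (\<forall>\<alpha>\<in>A. (g \<otimes>\<^bsub>E\<^esub> inv\<^bsub>E\<^esub> h) \<otimes>\<^bsub>E\<^esub> s \<alpha> = s \<alpha> \<otimes>\<^bsub>E\<^esub> (g \<otimes>\<^bsub>E\<^esub> inv\<^bsub>E\<^esub> h))"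
      using conj_eq_iff[OF gh] s S(1) A by (intro ball_cong) auto
    also have "\<dots> \<longleftrightarrow> g \<otimes>\<^bsub>E\<^esub> inv\<^bsub>E\<^esub> h \<in> centralizer E (s ` A)"
      using gh by (auto simp: centralizer_def)
    finally show ?thesis .
  qed
  have f_ext: "f ` carrier E \<subseteq> extensional (Field \<omega>\<^sub>1)" by (auto simp: f_def)
  show ?thesis
  proof (rule weak_Kurepa_tree_from_functions[OF f_ext])
    have "|rcosets\<^bsub>E\<^esub> (centralizer E S)| \<le>o |f ` carrier E|"
      using s by (intro card_of_rcosets_le centralizer_subgroup S(1)) (metis f_eq order_refl)
    then show "\<omega>\<^sub>2 \<le>o |f ` carrier E|"
      using S(3) ordLeq_transitive omega2_ordLeq_iff by blast
  next
    fix \<alpha> assume a: "\<alpha> \<in> Field \<omega>\<^sub>1"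
    have u: "under \<omega>\<^sub>1 \<alpha> \<subseteq> Field \<omega>\<^sub>1" by (auto simp: under_def Field_def)
    then have c: "s ` under \<omega>\<^sub>1 \<alpha> \<subseteq> carrier E" using s S(1) by blast
    have "|(\<lambda>g. restrict (f g) (under \<omega>\<^sub>1 \<alpha>)) ` carrier E| \<le>o |rcosets\<^bsub>E\<^esub> (centralizer E (s ` under \<omega>\<^sub>1 \<alpha>))|"
      using f_eq[OF _ _ u] by (intro card_of_image_le_rcosets centralizer_subgroup c) auto
    moreover have "index_le_omega1 E (centralizer E (s ` under \<omega>\<^sub>1 \<alpha>))"
      by (rule index_centralizer_countable[OF assms(3) c countable_image[OF countable_under_omega1[OF a]]])
    ultimately show "|(\<lambda>f. restrict f (under \<omega>\<^sub>1 \<alpha>)) ` f ` carrier E| \<le>o \<omega>\<^sub>1"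
      unfolding image_image using ordLeq_transitive by blast
  qed
qed

end
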